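(* There exists $y_0>0$ such that for all $y>y_0$ and all $n\ge1$, \[ \mathbb{P}\left(\sup_{0\leq s\leq1}\hat W^{(n)}_s\,>\,(8/9)^{1/4}y\right)\;\leq\; e^{-y}. \]
   Context: Let $U_n$ be uniform on the set of plane trees (rooted, children linearly ordered) with $n$ edges, with integer vertex labels such that adjacent labels differ by at most $1$ and the root has label $0$. The contour traversal of $U_n$ (depth-first traversal around the tree, one edge per unit of time, each edge crossed twice) visits vertices $v_0=\text{root},v_1,\dots,v_{2n}=\text{root}$. Let $V^{(n)}(t)$ be the label of $v_t$ and, for $0\le s\le1$, \[\hat W^{(n)}_s=\frac{V^{(n)}(\lfloor 2ns\rfloor)}{(8n/9)^{1/4}}.\] *)

theory Defs
  imports "HOL-Probability.Probability"
begin

datatype 'a plane_tree = Node (label: 'a) (children: "'a plane_tree list")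

fun edges :: "'a plane_tree \<Rightarrow> nat" where
  "edges (Node a ts) = (\<Sum>t\<leftarrow>ts. Suc (edges t))"

fun admissible :: "int plane_tree \<Rightarrow> bool" where
  "admissible (Node a ts) \<longleftrightarrow> (\<forall>t\<in>set ts. \<bar>label t - a\<bar> \<le> 1 \<and> admissible t)"

definition labelled_trees :: "nat \<Rightarrow> int plane_tree set" where
  "labelled_trees n = {T. edges T = n \<and> admissible T \<and> label T = 0}"

text \<open>The list of vertices \<open>v\<^sub>0, \<dots>, v\<^sub>2\<^sub>n\<close> met by the contour traversal. A vertex is represented by
  the subtree hanging from it, so a vertex is listed once on arrival and once more after the
  return from each of its children. Distinct vertices carrying equal labelled subtrees are not
  told apart, but they have the same label, and only the labels are read off below.\<close>

fun contour :: "'a plane_tree \<Rightarrow> 'a plane_tree list" where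
  "contour (Node a ts) = Node a ts # concat (map (\<lambda>t. contour t @ [Node a ts]) ts)"

definition V :: "int plane_tree \<Rightarrow> nat \<Rightarrow> int" where
  "V T k = label (contour T ! k)"

definition W_hat :: "nat \<Rightarrow> int plane_tree \<Rightarrow> real \<Rightarrow> real" where
  "W_hat n T s = real_of_int (V T (nat \<lfloor>2 * real n * s\<rfloor>)) / (8 * real n / 9) powr (1 / 4)"

definition U :: "nat \<Rightarrow> int plane_tree pmf" where
  "U n = pmf_of_set (labelled_trees n)"

text \<open>The facts below show that \<open>U n\<close> is a genuine uniform distribution, that \<open>V\<close> only
  accesses positions inside the contour list, and that the supremum of \<open>W_hat\<close> is that of a
  bounded set (elsewhere the corresponding constants are underspecified).\<close>

lemma length_contour: "length (contour T) = 2 * edges T + 1"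
proof (induction T)
  case (Node a ts)
  have "(\<Sum>t\<leftarrow>ts. Suc (length (contour t))) = 2 * (\<Sum>t\<leftarrow>ts. Suc (edges t))"
    using Node by (induction ts) auto
  then show ?case by (simp add: length_concat comp_def)
qed

lemma contour_first: "contour T ! 0 = T"
  by (cases T) simp

lemma contour_last: "contour T ! (2 * edges T) = T"
proof -
  have "last (contour T) = T"
  proof (cases T)
    case (Node a ts)
    then show ?thesis by (cases ts rule: rev_cases) auto
  qed
  moreover have "contour T \<noteq> []" by (cases T) simp
  ultimately show ?thesis using length_contour[of T] by (simp add: last_conv_nth)
qed

lemma finite_admissible: "finite {T. edges T = n \<and> admissible T \<and> label T = a}"
proof (induction n arbitrary: a rule: less_induct)
  case (less n)
  let ?S = "\<lambda>k b. {T. edges T = k \<and> admissible T \<and> label T = b}"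
  let ?B = "\<Union>k\<in>{..<n}. \<Union>b\<in>{a - 1..a + 1}. ?S k b"
  have fin: "finite (Node a ` {ts. set ts \<subseteq> ?B \<and> length ts \<le> n})"
    using less by (intro finite_imageI finite_lists_length_le) auto
  have "?S n a \<subseteq> Node a ` {ts. set ts \<subseteq> ?B \<and> length ts \<le> n}"
  proof
    fix T assume T: "T \<in> ?S n a"
    then obtain ts where ts: "T = Node a ts" by (cases T) auto
    have lt: "edges t < n" if "t \<in> set ts" for t
      using T ts member_le_sum_list[of "Suc (edges t)" "map (\<lambda>t. Suc (edges t)) ts"] that
      by auto
    have "length us \<le> (\<Sum>t\<leftarrow>us. Suc (edges t))" for us :: "int plane_tree list"
      by (induction us) auto
    then have "length ts \<le> n" using T ts by auto
    moreover have "set ts \<subseteq> ?B" using lt T ts by fastforce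
    ultimately show "T \<in> Node a ` {ts. set ts \<subseteq> ?B \<and> length ts \<le> n}" using ts by blast
  qed
  then show ?case using fin finite_subset by blast
qed

lemma finite_labelled_trees: "finite (labelled_trees n)"
  unfolding labelled_trees_def by (rule finite_admissible)

lemma labelled_trees_nonempty: "labelled_trees n \<noteq> {}"
proof -
  have "Node 0 (replicate n (Node 0 [])) \<in> labelled_trees n"
    by (simp add: labelled_trees_def sum_list_replicate)
  then show ?thesis by blast
qed

lemma set_pmf_U: "set_pmf (U n) = labelled_trees n"
  unfolding U_def using finite_labelled_trees labelled_trees_nonempty by simp

lemma contour_index_less:
  assumes "T \<in> labelled_trees n" "s \<in> {0..1}"
  shows "nat \<lfloor>2 * real n * s\<rfloor> < length (contour T)"
proof -
  have "2 * real n * s \<le> 2 * real n * 1"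
    using assms(2) by (intro mult_left_mono) auto
  then have "\<lfloor>2 * real n * s\<rfloor> \<le> 2 * int n" by linarith
  then show ?thesis using assms(1) by (simp add: length_contour labelled_trees_def)
qed

lemma bdd_above_W_hat:
  assumes "T \<in> labelled_trees n"
  shows "bdd_above (W_hat n T ` {0..1})"
proof (rule bdd_above_mono)
  let ?g = "\<lambda>k. real_of_int (V T k) / (8 * real n / 9) powr (1 / 4)"
  show "bdd_above (?g ` {..<length (contour T)})" by (intro bdd_above_finite) auto
  show "W_hat n T ` {0..1} \<subseteq> ?g ` {..<length (contour T)}"
    using contour_index_less[OF assms] by (auto simp: W_hat_def)
qed

end

theory Submission
  imports Defs
begin

text \<open>Splitting off the first child of the root, the probability that \<open>U n\<close> has all labels below
  \<open>l\<close> is a mean over the sizes of the two parts, and the size distribution for \<open>n + 1\<close> edges is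
  obtained from that for \<open>n\<close> edges by enlarging one of the parts (Luczak--Winkler). Hence the
  probability \<open>P\<^sub>n(l)\<close> of reaching \<open>l\<close> increases with \<open>n\<close>, and
  \<open>P\<^sub>n(l) (\<Sum>m\<ge>n. c\<^sub>m z\<^sup>m) \<le> (\<Sum>m. P\<^sub>m(l) c\<^sub>m z\<^sup>m)\<close> for the number \<open>c\<^sub>m = 3\<^sup>m Cat\<^sub>m\<close> of labelled
  trees. The right-hand side has a closed form, of order \<open>x\<^sup>l (1 - x)\<^sup>2\<close> where
  \<open>1 - 12 z \<approx> (1 - x)\<^sup>4 / 36\<close>; the sum on the left has order \<open>n\<^sup>-\<^sup>1\<^sup>/\<^sup>2\<close> when \<open>1 - 12 z\<close> has
  order \<open>1 / n\<close>. Taking \<open>1 - x \<approx> 2 n\<^sup>-\<^sup>1\<^sup>/\<^sup>4\<close> the powers of \<open>n\<close> cancel, leaving \<open>P\<^sub>n(l) = O(x\<^sup>l)\<close>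
  with \<open>x\<^sup>l \<approx> exp (- 2 l n\<^sup>-\<^sup>1\<^sup>/\<^sup>4)\<close>.\<close>

section \<open>Catalan numbers and the comparison of size distributions\<close>

fun catalan :: "nat \<Rightarrow> nat" where
  "catalan 0 = 1"
| "catalan (Suc n) = (\<Sum>i\<le>n. catalan i * catalan (n - i))"

lemma catalan_pos: "catalan n > 0"
proof (induction n rule: less_induct)
  case (less n)
  show ?case
  proof (cases n)
    case (Suc m)
    have "0 < catalan 0 * catalan (m - 0)" using less Suc by simp
    also have "\<dots> \<le> (\<Sum>i\<le>m. catalan i * catalan (m - i))" by (rule member_le_sum) auto
    finally show ?thesis using Suc by simp
  qed simp
qed

text \<open>Differentiating \<open>C = 1 + fps_X * C\<^sup>2\<close> and eliminating the square
  gives a linear first-order differential equation for \<open>C\<close>; the recurrence is its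
  coefficient at \<open>Suc n\<close>.\<close>

lemma catalan_Suc_ratio: "(real n + 2) * real (catalan (Suc n)) = (4 * real n + 2) * real (catalan n)"
proof -
  define C :: "real fps" where "C = Abs_fps (\<lambda>n. real (catalan n))"
  have C: "C = 1 + fps_X * C\<^sup>2"
  proof (rule fps_ext)
    fix n
    show "fps_nth C n = fps_nth (1 + fps_X * C\<^sup>2) n"
      by (cases n) (auto simp: C_def power2_eq_square fps_mult_nth[of "Abs_fps _"]
        atMost_atLeast0 fps_X_mult_nth mult.assoc)
  qed
  have "fps_deriv C = fps_deriv (1 + fps_X * C\<^sup>2)" using C by simp
  then have dC: "fps_deriv C = C\<^sup>2 + 2 * fps_X * C * fps_deriv C"
    by (simp add: power2_eq_square algebra_simps)
  have "fps_X * fps_deriv C * (1 - 4 * fps_X) = 1 - C + 2 * fps_X * C"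
    using C dC by algebra
  then have "fps_X * fps_deriv C - fps_const 4 * (fps_X * (fps_X * fps_deriv C))
      = 1 - C + fps_const 2 * (fps_X * C)"
    unfolding numeral_fps_const[symmetric] by (simp add: algebra_simps)
  then have "fps_nth (fps_X * fps_deriv C - fps_const 4 * (fps_X * (fps_X * fps_deriv C))) (Suc n)
      = fps_nth (1 - C + fps_const 2 * (fps_X * C)) (Suc n)"
    by simp
  then show ?thesis
    by (cases n) (simp_all add: C_def algebra_simps del: catalan.simps)
qed

text \<open>The ratio \<open>(4 k + 2) / (k + 2)\<close> of consecutive Catalan numbers increases
  with \<open>k\<close>.\<close>

lemma catalan_log_convex:
  assumes "m \<le> n"
  shows "real (catalan (Suc m)) * real (catalan n) \<le> real (catalan m) * real (catalan (Suc n))"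
proof -
  have r: "real (catalan (Suc k)) = (4 * real k + 2) / (real k + 2) * real (catalan k)" for k
    using catalan_Suc_ratio[of k] by (simp add: field_simps)
  have "(4 * real m + 2) / (real m + 2) \<le> (4 * real n + 2) / (real n + 2)"
    using assms by (simp add: field_simps)
  then have "(4 * real m + 2) / (real m + 2) * (real (catalan m) * real (catalan n))
      \<le> (4 * real n + 2) / (real n + 2) * (real (catalan m) * real (catalan n))"
    by (rule mult_right_mono) simp
  then show ?thesis unfolding r by (simp add: mult_ac)
qed

text \<open>Induction with the exact ratio; \<open>gm\<close> compares the two square roots. The
  constant 2 gives equality at \<open>n = 1\<close>.\<close>

lemma catalan_lower_bound:
  assumes "n \<ge> 1"
  shows "4 ^ n \<le> 2 * sqrt n * (real n + 1) * real (catalan n)"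
  using assms
proof (induction n rule: dec_induct)
  case base
  then show ?case by simp
next
  case (step n)
  have gm: "2 * (sqrt n * sqrt (Suc n)) \<le> 2 * real n + 1"
    using arith_geo_mean_sqrt[of "real n" "real n + 1"]
    by (simp add: real_sqrt_mult[symmetric] algebra_simps)
  have "4 ^ Suc n \<le> 8 * sqrt n * (real n + 1) * real (catalan n)"
    using mult_left_mono[OF step.IH, of 4] by (simp add: mult_ac)
  also have "\<dots> = 4 * sqrt (Suc n) * real (catalan n) * (2 * (sqrt n * sqrt (Suc n)))"
    by (simp add: mult_ac)
  also have "\<dots> \<le> 4 * sqrt (Suc n) * real (catalan n) * (2 * real n + 1)"
    using gm by (intro mult_left_mono) auto
  also have "\<dots> = 2 * sqrt (Suc n) * ((4 * real n + 2) * real (catalan n))"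
    by (simp add: algebra_simps)
  also have "\<dots> = 2 * sqrt (Suc n) * (real (Suc n) + 1) * real (catalan (Suc n))"
    unfolding catalan_Suc_ratio[symmetric] by (simp add: add.commute)
  finally show ?case .
qed

text \<open>The mass \<open>\<pi> i\<close> at \<open>i\<close> is transported to \<open>i\<close> and \<open>i + 1\<close>, the amount moved being the \<open>\<beta> i\<close> of
  the proof.\<close>

lemma transport_sum_le:
  fixes p \<pi> F f :: "nat \<Rightarrow> real"
  assumes total: "sum p {..Suc m} = sum \<pi> {..m}"
    and stay: "\<And>i. i \<le> m \<Longrightarrow> p i \<le> \<pi> i" and move: "\<And>i. i \<le> m \<Longrightarrow> p (Suc i) \<le> \<pi> i"
    and F: "\<And>i. i \<le> m \<Longrightarrow> F i \<le> f i" "\<And>i. i \<le> m \<Longrightarrow> F (Suc i) \<le> f i"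
  shows "(\<Sum>i\<le>Suc m. p i * F i) \<le> (\<Sum>i\<le>m. \<pi> i * f i)"
proof -
  define \<beta> where "\<beta> k = sum \<pi> {..k} - sum p {..k}" for k
  have nonneg: "0 \<le> \<beta> k" if "k \<le> m" for k
    unfolding \<beta>_def using sum_mono[of "{..k}" p \<pi>] stay that by simp
  \<comment> \<open>By \<open>total\<close>, \<open>\<pi> k - \<beta> k\<close> is the mass of
    \<open>\<pi>\<close> on \<open>{k..m}\<close> minus that of \<open>p\<close> on
    \<open>{Suc k..Suc m}\<close>, which \<open>move\<close> makes nonnegative.\<close>
  have le: "\<beta> k \<le> \<pi> k" if "k \<le> m" for k
  proof -
    have "(\<Sum>i=k..m. p (Suc i)) \<le> sum \<pi> {k..m}" using move by (intro sum_mono) auto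
    moreover have "(\<Sum>i=k..m. p (Suc i)) = sum p {Suc k..Suc m}"
      by (rule sum.shift_bounds_cl_Suc_ivl[symmetric])
    moreover have "sum p {..Suc m} = sum p {..k} + sum p {Suc k..Suc m}"
    proof -
      have "{..Suc m} = {..k} \<union> {Suc k..Suc m}" using that by auto
      then show ?thesis by (simp only:) (rule sum.union_disjoint, auto)
    qed
    moreover have "sum \<pi> {..m} + \<pi> k = sum \<pi> {..k} + sum \<pi> {k..m}"
    proof -
      have "{..m} = {..<k} \<union> {k..m}" using that by auto
      then have "sum \<pi> {..m} = sum \<pi> {..<k} + sum \<pi> {k..m}"
        by (simp only:) (rule sum.union_disjoint, auto)
      then show ?thesis by (simp add: lessThan_Suc_atMost[symmetric])
    qed
    ultimately show ?thesis unfolding \<beta>_def using total by linarith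
  qed
  \<comment> \<open>The left side is the mass in transit from \<open>k\<close> to
    \<open>Suc k\<close>, valued at its destination. For \<open>k = m\<close> it is the missing term
    \<open>p (Suc m) * F (Suc m)\<close>.\<close>
  have "\<beta> k * F (Suc k) \<le> (\<Sum>i\<le>k. \<pi> i * f i) - (\<Sum>i\<le>k. p i * F i)" if "k \<le> m" for k
    using that
  proof (induction k)
    case 0
    have "\<beta> 0 * F (Suc 0) \<le> \<beta> 0 * f 0" using F nonneg[of 0] by (intro mult_left_mono) auto
    moreover have "(\<pi> 0 - \<beta> 0) * F 0 \<le> (\<pi> 0 - \<beta> 0) * f 0"
      using F le[of 0] by (intro mult_left_mono) auto
    ultimately show ?case by (simp add: \<beta>_def algebra_simps)
  next
    case (Suc k)
    have \<beta>_Suc: "\<beta> (Suc k) = \<beta> k + \<pi> (Suc k) - p (Suc k)" by (simp add: \<beta>_def)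
    have "\<beta> (Suc k) * F (Suc (Suc k)) \<le> \<beta> (Suc k) * f (Suc k)"
      using F nonneg Suc by (intro mult_left_mono) auto
    also have "\<dots> = (\<beta> k + \<pi> (Suc k) - p (Suc k)) * f (Suc k)" by (simp only: \<beta>_Suc)
    finally have "\<beta> (Suc k) * F (Suc (Suc k)) \<le> (\<beta> k + \<pi> (Suc k) - p (Suc k)) * f (Suc k)" .
    moreover have "(p (Suc k) - \<beta> k) * F (Suc k) \<le> (p (Suc k) - \<beta> k) * f (Suc k)"
      using F le[of "Suc k"] Suc by (intro mult_left_mono) (auto simp: \<beta>_Suc)
    moreover have "\<beta> k * F (Suc k) \<le> (\<Sum>i\<le>k. \<pi> i * f i) - (\<Sum>i\<le>k. p i * F i)"
      using Suc by simp
    ultimately show ?case by (simp add: algebra_simps)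
  qed
  from this[of m] have "\<beta> m * F (Suc m) \<le> (\<Sum>i\<le>m. \<pi> i * f i) - (\<Sum>i\<le>m. p i * F i)" by simp
  moreover have "\<beta> m = p (Suc m)" using total by (simp add: \<beta>_def)
  ultimately show ?thesis by simp
qed

text \<open>Log-convexity yields the mass conditions of \<open>transport_sum_le\<close>: the weight
  at \<open>i\<close> for \<open>m\<close> dominates those at \<open>i\<close> and
  \<open>Suc i\<close> for \<open>Suc m\<close>. Enlarging either part does not increase the product
  of \<open>g\<close> and \<open>h\<close>.\<close>

lemma catalan_mean_antimono:
  fixes g h :: "nat \<Rightarrow> real"
  assumes nonneg: "\<And>i. 0 \<le> g i" "\<And>i. 0 \<le> h i"
    and g: "\<And>i. i \<le> m \<Longrightarrow> g (Suc i) \<le> g i" and h: "\<And>i. i \<le> m \<Longrightarrow> h (Suc i) \<le> h i"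
  shows "(\<Sum>i\<le>Suc m. real (catalan i * catalan (Suc m - i)) * (g i * h (Suc m - i))) / catalan (Suc (Suc m))
    \<le> (\<Sum>i\<le>m. real (catalan i * catalan (m - i)) * (g i * h (m - i))) / catalan (Suc m)"
proof -
  have pos: "real (catalan k) > 0" for k using catalan_pos by simp
  have one: "(\<Sum>i\<le>k. real (catalan i * catalan (k - i)) / catalan (Suc k)) = 1" for k
    using pos[of "Suc k"] by (simp only: sum_divide_distrib[symmetric] of_nat_sum[symmetric] catalan.simps(2)[symmetric]) simp
  have "(\<Sum>i\<le>Suc m. real (catalan i * catalan (Suc m - i)) / catalan (Suc (Suc m)) * (g i * h (Suc m - i)))
    \<le> (\<Sum>i\<le>m. real (catalan i * catalan (m - i)) / catalan (Suc m) * (g i * h (m - i)))"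
  proof (rule transport_sum_le)
    show "(\<Sum>i\<le>Suc m. real (catalan i * catalan (Suc m - i)) / catalan (Suc (Suc m)))
      = (\<Sum>i\<le>m. real (catalan i * catalan (m - i)) / catalan (Suc m))"
      by (simp only: one)
  next
    fix i assume i: "i \<le> m"
    have "real (catalan i) * (real (catalan (Suc (m - i))) * catalan (Suc m))
        \<le> real (catalan i) * (real (catalan (m - i)) * catalan (Suc (Suc m)))"
      by (intro mult_left_mono catalan_log_convex) auto
    then show "real (catalan i * catalan (Suc m - i)) / catalan (Suc (Suc m))
        \<le> real (catalan i * catalan (m - i)) / catalan (Suc m)"
      using pos[of "Suc m"] pos[of "Suc (Suc m)"] i by (simp add: Suc_diff_le field_simps del: catalan.simps)
    have "real (catalan (m - i)) * (real (catalan (Suc i)) * catalan (Suc m))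
        \<le> real (catalan (m - i)) * (real (catalan i) * catalan (Suc (Suc m)))"
      using i by (intro mult_left_mono catalan_log_convex) auto
    then show "real (catalan (Suc i) * catalan (Suc m - Suc i)) / catalan (Suc (Suc m))
        \<le> real (catalan i * catalan (m - i)) / catalan (Suc m)"
      using pos[of "Suc m"] pos[of "Suc (Suc m)"] i by (simp add: field_simps del: catalan.simps)
    show "g i * h (Suc m - i) \<le> g i * h (m - i)"
      using i h[of "m - i"] nonneg by (simp add: Suc_diff_le mult_left_mono)
    show "g (Suc i) * h (Suc m - Suc i) \<le> g i * h (m - i)"
      using i g[of i] nonneg by (simp add: mult_right_mono)
  qed
  then show ?thesis by (simp only: sum_divide_distrib times_divide_eq_left)
qed

section \<open>Counting trees with confined labels\<close>

text \<open>\<open>S = {..<int l}\<close> describes trees that never reach \<open>l\<close>, and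
  \<open>S = UNIV\<close> all trees. The root label is a parameter because the subtree at the first
  child may start from another label.\<close>

definition trees :: "int set \<Rightarrow> nat \<Rightarrow> int \<Rightarrow> int plane_tree set" where
  "trees S n a = {T. edges T = n \<and> admissible T \<and> label T = a \<and> set_plane_tree T \<subseteq> S}"

lemma finite_trees: "finite (trees S n a)"
  by (rule finite_subset[OF _ finite_admissible[of n a]]) (auto simp: trees_def)

lemma trees_not_mem: "a \<notin> S \<Longrightarrow> trees S n a = {}"
proof -
  have "label T \<in> set_plane_tree T" for T :: "int plane_tree" by (cases T) auto
  then show "a \<notin> S \<Longrightarrow> trees S n a = {}" by (auto simp: trees_def)
qed

lemma trees_0: "a \<in> S \<Longrightarrow> trees S 0 a = {Node a []}"
proof -
  assume a: "a \<in> S"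
  have "T = Node a []" if "T \<in> trees S 0 a" for T
  proof (cases T)
    case (Node b ts)
    then show ?thesis using that by (cases ts) (auto simp: trees_def)
  qed
  moreover have "Node a [] \<in> trees S 0 a" using a by (simp add: trees_def)
  ultimately show ?thesis by blast
qed

text \<open>The first child \<open>t\<close> is cut off with its subtree; the rest keeps the root,
  and the cut edge accounts for the drop from \<open>Suc n\<close> to \<open>n\<close>.\<close>

lemma trees_Suc:
  "trees S (Suc n) a = (\<Union>i\<le>n. (\<lambda>(t, T). Node a (t # children T)) `
     ((\<Union>b\<in>{a - 1..a + 1}. trees S i b) \<times> trees S (n - i) a))" (is "_ = ?R")
proof (intro equalityI subsetI)
  fix T assume T: "T \<in> trees S (Suc n) a"
  obtain b us where bus: "T = Node b us" by (cases T)
  with T obtain t ts where us: "us = t # ts" by (cases us) (auto simp: trees_def)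
  have t: "t \<in> (\<Union>b\<in>{a - 1..a + 1}. trees S (edges t) b)"
    and r: "Node a ts \<in> trees S (n - edges t) a" and i: "edges t \<le> n" and b: "b = a"
    using T bus us by (auto simp: trees_def)
  have "T = (\<lambda>(t, T). Node a (t # children T)) (t, Node a ts)" using bus us b by simp
  then show "T \<in> ?R" using t r i by blast
next
  fix T assume "T \<in> ?R"
  then obtain i t T' where *: "i \<le> n" "t \<in> (\<Union>b\<in>{a - 1..a + 1}. trees S i b)"
    "T' \<in> trees S (n - i) a" "T = Node a (t # children T')" by auto
  then show "T \<in> trees S (Suc n) a"
    by (cases T') (auto simp: trees_def)
qed

definition num_trees :: "int set \<Rightarrow> nat \<Rightarrow> int \<Rightarrow> real" where
  "num_trees S n a = real (card (trees S n a))"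

lemma num_trees_nonneg [simp]: "num_trees S n a \<ge> 0"
  by (simp add: num_trees_def)

lemma num_trees_0: "a \<in> S \<Longrightarrow> num_trees S 0 a = 1"
  by (simp add: num_trees_def trees_0)

lemma num_trees_not_mem: "a \<notin> S \<Longrightarrow> num_trees S n a = 0"
  by (simp add: num_trees_def trees_not_mem)

lemma num_trees_Suc:
  "num_trees S (Suc n) a =
     (\<Sum>i\<le>n. (num_trees S i (a - 1) + num_trees S i a + num_trees S i (a + 1)) * num_trees S (n - i) a)"
proof -
  let ?f = "\<lambda>(t, T). Node a (t # children T)"
  let ?X = "\<lambda>i. (\<Union>b\<in>{a - 1..a + 1}. trees S i b)"
  have nb: "{a - 1..a + 1} = {a - 1, a, a + 1}" by auto
  have X: "card (?X i) = card (trees S i (a - 1)) + card (trees S i a) + card (trees S i (a + 1))" for i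
  proof -
    have "card (?X i) = (\<Sum>b\<in>{a - 1..a + 1}. card (trees S i b))"
      by (rule card_UN_disjoint) (auto simp: finite_trees, auto simp: trees_def)
    then show ?thesis unfolding nb by simp
  qed
  have inj: "inj_on ?f (A \<times> trees S k a)" for A k
  proof (rule inj_onI)
    fix u v assume "u \<in> A \<times> trees S k a" "v \<in> A \<times> trees S k a" "?f u = ?f v"
    then show "u = v"
      by (cases u; cases v; cases "snd u"; cases "snd v") (auto simp: trees_def)
  qed
  have "card (trees S (Suc n) a) = (\<Sum>i\<le>n. card (?f ` (?X i \<times> trees S (n - i) a)))"
    unfolding trees_Suc
  proof (rule card_UN_disjoint)
    show "\<forall>i\<in>{..n}. \<forall>j\<in>{..n}. i \<noteq> j \<longrightarrow>
      ?f ` (?X i \<times> trees S (n - i) a) \<inter> ?f ` (?X j \<times> trees S (n - j) a) = {}"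
      by (auto simp: trees_def)
  qed (auto simp: finite_trees)
  also have "\<dots> = (\<Sum>i\<le>n. card (?X i) * card (trees S (n - i) a))"
    by (simp add: card_image[OF inj] card_cartesian_product)
  finally show ?thesis by (simp add: num_trees_def X)
qed

lemma num_trees_UNIV: "num_trees UNIV n a = 3 ^ n * real (catalan n)"
proof (induction n arbitrary: a rule: less_induct)
  case (less n)
  show ?case
  proof (cases n)
    case 0
    then show ?thesis by (simp add: num_trees_0)
  next
    case (Suc m)
    have gen: "(p * c * u + p * c * v + p * c * w) * (r * d * e)
        = 3 * (p * r) * (c * d * ((u + v + w) / 3 * e))" for p c u v w r d e :: real
      by (simp add: algebra_simps)
    have pow: "(3 :: real) ^ m = 3 ^ i * 3 ^ (m - i)" if "i \<le> m" for i
      using that by (simp flip: power_add)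
    have IH: "num_trees UNIV i b = 3 ^ i * real (catalan i)" if "i \<le> m" for i b
      using less that Suc by simp
    have "num_trees UNIV n a = (\<Sum>i\<le>m. 3 ^ n * (real (catalan i) * real (catalan (m - i))))"
      unfolding Suc num_trees_Suc
    proof (intro sum.cong refl)
      fix i assume "i \<in> {..m}"
      then show "(num_trees UNIV i (a - 1) + num_trees UNIV i a + num_trees UNIV i (a + 1)) * num_trees UNIV (m - i) a
          = 3 ^ Suc m * (real (catalan i) * real (catalan (m - i)))"
        using gen[of "3 ^ i" "real (catalan i)" 1 1 1 "3 ^ (m - i)" "real (catalan (m - i))" 1]
        by (simp only: IH pow[of i] power_Suc atMost_iff diff_le_self) simp
    qed
    then show ?thesis by (simp add: Suc sum_distrib_left)
  qed
qed

lemma num_trees_mono: "S \<subseteq> S' \<Longrightarrow> num_trees S n a \<le> num_trees S' n a"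
  unfolding num_trees_def by (intro of_nat_mono card_mono finite_trees) (auto simp: trees_def)

section \<open>Monotonicity in the number of edges\<close>

text \<open>Induction for all root labels at once, since \<open>g\<close> averages over the three
  labels of the first child. The recursion turns \<open>q (Suc m) a\<close> into a Catalan mean of
  products, so \<open>catalan_mean_antimono\<close> applies; the step from 0 to 1 edges is checked
  directly.\<close>

lemma proportion_antimono:
  "num_trees S (Suc n) a / num_trees UNIV (Suc n) 0 \<le> num_trees S n a / num_trees UNIV n 0"
proof (induction n arbitrary: a rule: less_induct)
  case (less n)
  define q where "q n a = num_trees S n a / num_trees UNIV n 0" for n a
  have c: "num_trees S n a = 3 ^ n * real (catalan n) * q n a" for n a
    using catalan_pos[of n] by (simp add: q_def num_trees_UNIV)
  have nonneg: "q n a \<ge> 0" for n a by (simp add: q_def)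
  define g where "g i = (q i (a - 1) + q i a + q i (a + 1)) / 3" for i
  have q_Suc: "q (Suc m) a = (\<Sum>i\<le>m. real (catalan i * catalan (m - i)) * (g i * q (m - i) a)) / catalan (Suc m)" for m
  proof -
    have gen: "(p * c * u + p * c * v + p * c * w) * (r * d * e)
        = 3 * (p * r) * (c * d * ((u + v + w) / 3 * e))" for p c u v w r d e :: real
      by (simp add: algebra_simps)
    have pow: "(3 :: real) ^ m = 3 ^ i * 3 ^ (m - i)" if "i \<le> m" for i
      using that by (simp flip: power_add)
    have "num_trees S (Suc m) a =
        3 ^ Suc m * (\<Sum>i\<le>m. real (catalan i * catalan (m - i)) * (g i * q (m - i) a))"
      unfolding num_trees_Suc sum_distrib_left
    proof (intro sum.cong refl)
      fix i assume "i \<in> {..m}"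
      then show "(num_trees S i (a - 1) + num_trees S i a + num_trees S i (a + 1)) * num_trees S (m - i) a
          = 3 ^ Suc m * (real (catalan i * catalan (m - i)) * (g i * q (m - i) a))"
        by (simp only: c g_def of_nat_mult power_Suc pow[of i] atMost_iff gen)
    qed
    then show ?thesis by (simp add: q_def num_trees_UNIV del: catalan.simps)
  qed
  have "q (Suc n) a \<le> q n a"
  proof (cases n)
    case 0
    then show ?thesis
    proof (cases "a \<in> S")
      case True
      have "q 0 b \<le> 1" for b
        using num_trees_mono[of S UNIV 0 b] by (simp add: q_def num_trees_0)
      from this[of "a - 1"] this[of a] this[of "a + 1"] have "g 0 \<le> 1"
        unfolding g_def by simp
      moreover have "q 0 a = 1" using True by (simp add: q_def num_trees_0)
      ultimately show ?thesis
        unfolding 0 q_Suc[of 0] by simp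
    qed (simp add: q_def num_trees_not_mem)
  next
    case (Suc m)
    have IH: "q (Suc i) b \<le> q i b" if "i \<le> m" for i b
      using less[of i b] that Suc by (simp add: q_def)
    show ?thesis unfolding Suc q_Suc
    proof (rule catalan_mean_antimono)
      show "g (Suc i) \<le> g i" if "i \<le> m" for i
        using IH[OF that, of "a - 1"] IH[OF that, of a] IH[OF that, of "a + 1"]
        unfolding g_def by (intro divide_right_mono add_mono) auto
      show "0 \<le> g i" for i
        using nonneg[of i "a - 1"] nonneg[of i a] nonneg[of i "a + 1"] unfolding g_def by simp
    qed (use IH nonneg in auto)
  qed
  then show ?case by (simp add: q_def)
qed

section \<open>Generating functions: equation, comparison, explicit solution\<close>

definition gf :: "real \<Rightarrow> int set \<Rightarrow> int \<Rightarrow> real" where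
  "gf z S a = (\<Sum>n. num_trees S n a * z ^ n)"

text \<open>For \<open>z > 0\<close> the conditions on \<open>R\<close> select the smaller root of
  the quadratic equation for the generating function of all trees, away from the double root at
  \<open>z = 1 / 12\<close>.\<close>

locale subcritical =
  fixes z R :: real
  assumes z: "z \<ge> 0" and R: "R \<ge> 0" "R = 1 + 3 * z * R\<^sup>2" "3 * z * R\<^sup>2 < 1"
begin

text \<open>The terms are nonnegative, so the triangular part of a squared partial sum is at most
  the full square; hence a bound \<open>R\<close> passes to the next partial sum as
  \<open>1 + 3 * z * R\<^sup>2 = R\<close>.\<close>

lemma partial_sum_le: "(\<Sum>n<N. num_trees UNIV n a * z ^ n) \<le> R"
proof (induction N)
  case 0
  show ?case using R by simp
next
  case (Suc N)
  define f where "f n = num_trees UNIV n a * z ^ n" for n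
  have f: "f n \<ge> 0" for n using z by (simp add: f_def)
  have f_Suc: "f (Suc n) = 3 * z * (\<Sum>i\<le>n. f i * f (n - i))" for n
  proof -
    have "num_trees UNIV i b = num_trees UNIV i a" for i b by (simp add: num_trees_UNIV)
    from this[of _ "a - 1"] this[of _ "a + 1"]
    have "num_trees UNIV (Suc n) a = (\<Sum>i\<le>n. 3 * (num_trees UNIV i a * num_trees UNIV (n - i) a))"
      unfolding num_trees_Suc by (intro sum.cong) simp_all
    then have "f (Suc n) = (\<Sum>i\<le>n. 3 * (num_trees UNIV i a * num_trees UNIV (n - i) a) * z ^ Suc n)"
      by (simp only: f_def sum_distrib_right)
    also have "\<dots> = (\<Sum>i\<le>n. 3 * z * (f i * f (n - i)))"
    proof (intro sum.cong refl)
      fix i assume "i \<in> {..n}"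
      then have "z ^ Suc n = z * (z ^ i * z ^ (n - i))" by (simp flip: power_add)
      then show "3 * (num_trees UNIV i a * num_trees UNIV (n - i) a) * z ^ Suc n = 3 * z * (f i * f (n - i))"
        unfolding f_def by (simp only: mult_ac)
    qed
    finally show ?thesis by (simp add: sum_distrib_left)
  qed
  have "(\<Sum>n<N. \<Sum>i\<le>n. f i * f (n - i)) = (\<Sum>(i, j)\<in>{(i, j). i + j < N}. f i * f j)"
    by (rule sum.triangle_reindex[symmetric])
  also have "\<dots> \<le> (\<Sum>(i, j)\<in>{..<N} \<times> {..<N}. f i * f j)"
    by (rule sum_mono2) (auto simp: f)
  also have "\<dots> = (\<Sum>i<N. f i)\<^sup>2"
    by (simp add: power2_eq_square sum_product sum.cartesian_product)
  also have "\<dots> \<le> R\<^sup>2"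
    using Suc by (intro power_mono) (auto simp: f_def[symmetric] intro!: sum_nonneg f)
  finally have "(\<Sum>n<N. \<Sum>i\<le>n. f i * f (n - i)) \<le> R\<^sup>2" .
  then have "3 * z * (\<Sum>n<N. \<Sum>i\<le>n. f i * f (n - i)) \<le> 3 * z * R\<^sup>2"
    using z by (intro mult_left_mono) auto
  moreover have "(\<Sum>n<Suc N. f n) = 1 + 3 * z * (\<Sum>n<N. \<Sum>i\<le>n. f i * f (n - i))"
    unfolding sum.lessThan_Suc_shift f_Suc sum_distrib_left[symmetric] by (simp add: f_def num_trees_0)
  ultimately show ?case using R by (simp add: f_def)
qed

lemma summable_UNIV: "summable (\<lambda>n. num_trees UNIV n a * z ^ n)"
  using z partial_sum_le by (intro summableI_nonneg_bounded[where x = R]) auto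

lemma summable_num_trees: "summable (\<lambda>n. num_trees S n a * z ^ n)"
  using z by (intro summable_comparison_test'[OF summable_UNIV[of a], of 0])
    (auto intro!: mult_right_mono num_trees_mono)

lemma gf_nonneg: "gf z S a \<ge> 0"
  unfolding gf_def using z by (intro suminf_nonneg summable_num_trees) auto

lemma gf_UNIV_le: "gf z UNIV a \<le> R"
  unfolding gf_def using z by (intro suminf_le_const summable_num_trees partial_sum_le)

lemma gf_mono: "S \<subseteq> S' \<Longrightarrow> gf z S a \<le> gf z S' a"
  unfolding gf_def using z by (intro suminf_le summable_num_trees mult_right_mono num_trees_mono) auto

lemma gf_UNIV_eq: "gf z UNIV a = gf z UNIV b"
  by (simp add: gf_def num_trees_UNIV)

lemma gf_eq:
  assumes "a \<in> S"
  shows "gf z S a = 1 + z * (gf z S (a - 1) + gf z S a + gf z S (a + 1)) * gf z S a"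
proof -
  define f where "f b n = num_trees S n b * z ^ n" for b n
  define g where "g n = f (a - 1) n + f a n + f (a + 1) n" for n
  have f: "summable (f b)" for b unfolding f_def by (rule summable_num_trees)
  have f0: "f b n \<ge> 0" for b n using z by (simp add: f_def)
  have g_nonneg: "g n \<ge> 0" for n using f0 by (simp add: g_def)
  have g: "summable g" "suminf g = gf z S (a - 1) + gf z S a + gf z S (a + 1)"
    unfolding g_def gf_def f_def[symmetric]
    by (simp_all add: suminf_add[symmetric] summable_add f del: summable_iff_shift)
  have "f a (Suc n) = z * (\<Sum>i\<le>n. g i * f a (n - i))" for n
  proof -
    have "f a (Suc n) = (\<Sum>i\<le>n. (num_trees S i (a - 1) + num_trees S i a + num_trees S i (a + 1))
        * num_trees S (n - i) a * z ^ Suc n)"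
      by (simp only: f_def num_trees_Suc sum_distrib_right)
    also have "\<dots> = (\<Sum>i\<le>n. z * (g i * f a (n - i)))"
    proof (intro sum.cong refl)
      fix i assume "i \<in> {..n}"
      then have "z ^ Suc n = z * (z ^ i * z ^ (n - i))" by (simp flip: power_add)
      then show "(num_trees S i (a - 1) + num_trees S i a + num_trees S i (a + 1)) * num_trees S (n - i) a * z ^ Suc n
          = z * (g i * f a (n - i))"
        unfolding f_def g_def by (simp only: distrib_right distrib_left mult_ac)
    qed
    finally show ?thesis by (simp add: sum_distrib_left)
  qed
  moreover have "(\<lambda>n. z * (\<Sum>i\<le>n. g i * f a (n - i))) sums (z * (suminf g * suminf (f a)))"
  proof (intro sums_mult Cauchy_product_sums)
    show "summable (\<lambda>k. norm (g k))" "summable (\<lambda>k. norm (f a k))"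
      using f[of a] g(1) f0 by (simp_all add: abs_of_nonneg g_nonneg)
  qed
  ultimately have "(\<Sum>n. f a (Suc n)) = z * (suminf g * suminf (f a))"
    by (simp add: sums_iff)
  then have "suminf (f a) - f a 0 = z * (suminf g * suminf (f a))"
    using suminf_split_head[OF f[of a]] by simp
  moreover have "f a 0 = 1" using assms by (simp add: f_def num_trees_0)
  moreover have "suminf (f a) = gf z S a" by (simp add: gf_def f_def[abs_def])
  ultimately show ?thesis using g by simp
qed

text \<open>Comparison by contraction: on \<open>S\<close>, the difference \<open>gf z UNIV a - gf z S a\<close> is an increasing
  \<open>z R\<^sup>2\<close>-Lipschitz function of the sum of the differences at \<open>a - 1\<close>, \<open>a\<close>, \<open>a + 1\<close>, and
  \<open>3 z R\<^sup>2 < 1\<close>.\<close>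

lemma gf_diff_le:
  fixes E :: "int \<Rightarrow> real"
  assumes E_nonneg: "\<And>a. E a \<ge> 0" and E_out: "\<And>a. a \<notin> S \<Longrightarrow> E a \<ge> R"
    and E_in: "\<And>a. a \<in> S \<Longrightarrow> E a * (1 + z * R * (E (a - 1) + E a + E (a + 1)))
        = z * R\<^sup>2 * (E (a - 1) + E a + E (a + 1))"
  shows "gf z UNIV a - gf z S a \<le> E a"
proof -
  define D where "D a = gf z UNIV a - gf z S a" for a
  define r where "r = gf z UNIV 0"
  have r: "gf z UNIV a = r" for a unfolding r_def by (rule gf_UNIV_eq)
  have r_eq: "r = 1 + 3 * z * r\<^sup>2"
    using gf_eq[of 0 UNIV] by (simp add: r power2_eq_square)
  have r_bounds: "0 \<le> r" "r \<le> R" unfolding r_def by (rule gf_nonneg gf_UNIV_le)+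
  have D_nonneg: "D a \<ge> 0" for a unfolding D_def by (simp add: gf_mono)
  have D_le: "D a \<le> R" for a
    unfolding D_def using gf_UNIV_le[of a] gf_nonneg[of S a] by simp
  \<comment> \<open>Subtract the equation of \<open>gf z S a\<close> from that of \<open>r\<close>
    and multiply by \<open>r\<close>, using \<open>r * (1 - 3 * z * r) = 1\<close>.\<close>
  have D_in: "D a * (1 + z * r * (D (a - 1) + D a + D (a + 1)))
      = z * r\<^sup>2 * (D (a - 1) + D a + D (a + 1))" if "a \<in> S" for a
    using gf_eq[OF that] r_eq unfolding D_def r by algebra
  define w where "w = z * R\<^sup>2"
  have w: "0 \<le> w" "3 * w < 1" using z R by (simp_all add: w_def)
  have step: "D a - E a \<le> 3 * w * M" if M: "M \<ge> 0" "\<And>a. D a - E a \<le> M" for M a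
  proof (cases "a \<in> S")
    case False
    then have "D a \<le> E a" using D_le[of a] E_out[of a] by simp
    moreover have "0 \<le> 3 * w * M" using w M by simp
    ultimately show ?thesis by linarith
  next
    case True
    define s where "s = D (a - 1) + D a + D (a + 1)"
    define t where "t = E (a - 1) + E a + E (a + 1)"
    have s: "s \<ge> 0" and t: "t \<ge> 0" and st: "s \<le> t + 3 * M"
      using D_nonneg E_nonneg M(2)[of "a - 1"] M(2)[of a] M(2)[of "a + 1"]
      by (simp_all add: s_def t_def)
    have pos: "1 + z * r * s > 0" "1 + z * R * s > 0" "1 + z * R * t > 0"
      using z R(1) r_bounds s t by (simp_all add: add_pos_nonneg)
    have "D a = z * r\<^sup>2 * s / (1 + z * r * s)"
      using D_in[OF True, folded s_def] pos by (simp add: eq_divide_eq)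
    \<comment> \<open>The fraction increases with \<open>r\<close>, so \<open>r \<le> R\<close>
      allows \<open>r\<close> to be replaced by \<open>R\<close>.\<close>
    also have "\<dots> \<le> z * R\<^sup>2 * s / (1 + z * R * s)"
    proof -
      have "r\<^sup>2 * (1 + z * R * s) \<le> R\<^sup>2 * (1 + z * r * s)"
      proof -
        have "r\<^sup>2 \<le> R\<^sup>2" using r_bounds by (intro power_mono) auto
        moreover have "z * s * r * R * r \<le> z * s * r * R * R"
          using r_bounds z s R(1) by (intro mult_left_mono) auto
        ultimately show ?thesis by (simp add: algebra_simps power2_eq_square)
      qed
      then have "z * s * (r\<^sup>2 * (1 + z * R * s)) \<le> z * s * (R\<^sup>2 * (1 + z * r * s))"
        using z s by (intro mult_left_mono) auto
      then show ?thesis using pos by (simp add: divide_le_eq pos_le_divide_eq mult_ac)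
    qed
    also have "\<dots> \<le> w * t / (1 + z * R * t) + 3 * w * M"
    proof -
      have "w * s / (1 + z * R * s) - w * t / (1 + z * R * t)
          = w * (s - t) / ((1 + z * R * s) * (1 + z * R * t))"
        using pos by (simp add: field_simps)
      also have "\<dots> \<le> w * (3 * M) / ((1 + z * R * s) * (1 + z * R * t))"
        using pos st w by (intro divide_right_mono mult_left_mono) auto
      also have "\<dots> \<le> w * (3 * M) / 1"
      proof (rule divide_left_mono)
        have "1 * 1 \<le> (1 + z * R * s) * (1 + z * R * t)"
          using z R(1) s t by (intro mult_mono) auto
        then show "1 \<le> (1 + z * R * s) * (1 + z * R * t)" by simp
      qed (use w M pos in auto)
      finally show ?thesis by (simp add: w_def)
    qed
    also have "w * t / (1 + z * R * t) = E a"
      using E_in[OF True, folded t_def] pos by (simp add: w_def divide_eq_eq)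
    finally show ?thesis by simp
  qed
  have iter: "D a - E a \<le> (3 * w) ^ k * R" for a k
  proof (induction k arbitrary: a)
    case 0
    show ?case using D_le[of a] E_nonneg[of a] by simp
  next
    case (Suc k)
    show ?case using step[OF _ Suc, of a] w R(1) by simp
  qed
  have "(\<lambda>k. (3 * w) ^ k * R) \<longlonglongrightarrow> 0"
    using w by (intro tendsto_mult_left_zero LIMSEQ_realpow_zero) auto
  then have "D a - E a \<le> 0"
    using iter by (intro LIMSEQ_le_const) auto
  then show ?thesis by (simp add: D_def)
qed

end

text \<open>With \<open>x + 1 + 1 / x = 1 / (z R\<^sup>2)\<close>, this is \<open>R - R\<^sub>l\<close> for the solution
  \<open>R\<^sub>l = R (1 - x\<^sup>l) (1 - x\<^bsup>l+3\<^esup>) / ((1 - x\<^bsup>l+1\<^esup>) (1 - x\<^bsup>l+2\<^esup>))\<close> of Bouttier, Di Francesco and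
  Guitter to \<open>R\<^sub>l = 1 + z R\<^sub>l (R\<^sub>l\<^sub>-\<^sub>1 + R\<^sub>l + R\<^sub>l\<^sub>+\<^sub>1)\<close>, \<open>R\<^sub>0 = 0\<close>.\<close>

definition gf_exceed :: "real \<Rightarrow> nat \<Rightarrow> real" where
  "gf_exceed x l = (1 + 4 * x + x\<^sup>2) / (1 + x + x\<^sup>2) * (x ^ l * (1 - x)\<^sup>2 * (1 + x))
     / ((1 - x ^ (l + 1)) * (1 - x ^ (l + 2)))"

text \<open>The value is \<open>R\<close>, the boundary condition \<open>E_out\<close> of
  \<open>gf_diff_le\<close>: all labels from \<open>l\<close> upwards are later sent to index
  0.\<close>

lemma gf_exceed_0:
  assumes "0 < x" "x < 1"
  shows "gf_exceed x 0 = (1 + 4 * x + x\<^sup>2) / (1 + x + x\<^sup>2)"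
proof -
  have "(1 - x) * (1 - x\<^sup>2) = (1 - x)\<^sup>2 * (1 + x)"
    by (simp add: power2_eq_square algebra_simps)
  moreover have "(1 - x)\<^sup>2 * (1 + x) \<noteq> 0" using assms by simp
  ultimately show ?thesis
    unfolding gf_exceed_def add_0 power_0 power_one_right mult_1_left times_divide_eq_left[symmetric]
    by simp
qed

lemma gf_exceed_nonneg: "0 < x \<Longrightarrow> x < 1 \<Longrightarrow> gf_exceed x l \<ge> 0"
  unfolding gf_exceed_def
  by (intro divide_nonneg_nonneg mult_nonneg_nonneg) (auto intro!: power_le_one simp del: power_Suc)

text \<open>After division by \<open>R\<close> the claim is \<open>w * \<tau> * (1 - e) = e\<close>.
  It holds because both factors collapse to products: \<open>\<tau>\<close> to
  \<open>c * x ^ k * (1 + x + x\<^sup>2) / (u 1 * u 4)\<close> by \<open>key\<close>, and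
  \<open>1 - e\<close> to \<open>u 1 * u 4 / (u 2 * u 3)\<close>.\<close>

lemma gf_exceed_Suc:
  fixes x :: real and k :: nat
  assumes x: "0 < x" "x < 1"
  defines "z \<equiv> x * (1 + x + x\<^sup>2) / (1 + 4 * x + x\<^sup>2)\<^sup>2" and "R \<equiv> (1 + 4 * x + x\<^sup>2) / (1 + x + x\<^sup>2)"
    and "t \<equiv> gf_exceed x k + gf_exceed x (k + 1) + gf_exceed x (k + 2)"
  shows "gf_exceed x (k + 1) * (1 + z * R * t) = z * R\<^sup>2 * t"
proof -
  define u where "u j = 1 - x ^ k * x ^ j" for j
  define c where "c = (1 - x)\<^sup>2 * (1 + x)"
  have u: "u j > 0" if "j > 0" for j
    using x that power_Suc_less_one[of x "k + j - 1"] unfolding u_def by (simp flip: power_add)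
  have ne: "u 1 \<noteq> 0" "u 2 \<noteq> 0" "u 3 \<noteq> 0" "u 4 \<noteq> 0" using u[of 1] u[of 2] u[of 3] u[of 4] by auto
  have pos: "1 + x + x\<^sup>2 > 0" "1 + 4 * x + x\<^sup>2 > 0" using x by (simp_all add: add_pos_nonneg)
  define e where "e = c * x ^ k * x / (u 2 * u 3)"
  define \<tau> where "\<tau> = c * x ^ k * (1 / (u 1 * u 2) + x / (u 2 * u 3) + x\<^sup>2 / (u 3 * u 4))"
  define w where "w = x / (1 + x + x\<^sup>2)"
  have E: "gf_exceed x (k + 1) = R * e" and t: "t = R * \<tau>"
    unfolding t_def gf_exceed_def R_def[symmetric] e_def \<tau>_def c_def u_def
    by (simp_all add: power_add eval_nat_numeral add_divide_distrib algebra_simps)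
  have zR: "z * R\<^sup>2 = w"
    using pos unfolding z_def R_def w_def by (simp add: power2_eq_square)
  have key: "u 3 * u 4 + x * u 1 * u 4 + x\<^sup>2 * u 1 * u 2 = (1 + x + x\<^sup>2) * u 2 * u 3"
    unfolding u_def by (simp add: eval_nat_numeral algebra_simps)
  have "\<tau> * (u 1 * u 2 * u 3 * u 4) = c * x ^ k * (u 3 * u 4 + x * u 1 * u 4 + x\<^sup>2 * u 1 * u 2)"
    unfolding \<tau>_def using ne by (simp add: divide_simps) (simp add: algebra_simps)
  then have "(\<tau> * (u 1 * u 4)) * (u 2 * u 3) = (c * x ^ k * (1 + x + x\<^sup>2)) * (u 2 * u 3)"
    unfolding key by (simp only: mult_ac)
  then have "\<tau> * (u 1 * u 4) = c * x ^ k * (1 + x + x\<^sup>2)"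
    using ne by (simp only: mult_cancel_right mult_eq_0_iff) simp
  then have w\<tau>: "w * \<tau> * (u 1 * u 4) = c * x ^ k * x"
    using pos unfolding w_def mult.assoc by simp
  have "(1 - e) * (u 2 * u 3) = u 1 * u 4"
    unfolding e_def c_def using ne
    by (simp add: left_diff_distrib) (simp add: u_def eval_nat_numeral algebra_simps)
  then have "w * \<tau> * (1 - e) * (u 2 * u 3) = e * (u 2 * u 3)"
    using w\<tau> ne by (simp add: e_def mult.assoc)
  then have "w * \<tau> * (1 - e) = e" using ne by simp
  moreover have "e * (1 + w * \<tau>) - w * \<tau> = e - w * \<tau> * (1 - e)" by (simp add: algebra_simps)
  ultimately have "e * (1 + w * \<tau>) = w * \<tau>" by simp
  then have "R * e * (1 + z * R\<^sup>2 * \<tau>) = R * (z * R\<^sup>2 * \<tau>)"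
    unfolding zR by simp
  then show ?thesis unfolding E t by (simp add: power2_eq_square mult_ac)
qed

text \<open>The constant 16 is 2 for the leading fraction, 2 for \<open>1 + x\<close>, and 4 for two
  denominators of at least \<open>1 / 2\<close>.\<close>

lemma gf_exceed_le:
  assumes x: "0 < x" "x < 1" and half: "x ^ l \<le> 1 / 2"
  shows "gf_exceed x l \<le> 16 * x ^ l * (1 - x)\<^sup>2"
proof -
  have "x ^ (l + 1) \<le> x ^ l" "x ^ (l + 2) \<le> x ^ l" using x by (intro power_decreasing; simp)+
  then have "1 / 2 \<le> 1 - x ^ (l + 1)" "1 / 2 \<le> 1 - x ^ (l + 2)" using half by linarith+
  then have denom: "1 / 2 * (1 / 2) \<le> (1 - x ^ (l + 1)) * (1 - x ^ (l + 2))"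
    by (rule mult_mono) (use \<open>1 / 2 \<le> 1 - x ^ (l + 1)\<close> in linarith, simp)
  have "(1 + 4 * x + x\<^sup>2) / (1 + x + x\<^sup>2) \<le> 2"
    using x zero_le_power2[of "1 - x"]
    by (simp add: divide_le_eq add_pos_nonneg power2_eq_square algebra_simps)
  moreover have "x ^ l * (1 - x)\<^sup>2 * (1 + x) \<le> x ^ l * (1 - x)\<^sup>2 * 2"
    using x by (intro mult_left_mono) auto
  ultimately have "(1 + 4 * x + x\<^sup>2) / (1 + x + x\<^sup>2) * (x ^ l * (1 - x)\<^sup>2 * (1 + x))
      \<le> 2 * (x ^ l * (1 - x)\<^sup>2 * 2)"
    using x by (intro mult_mono) auto
  from frac_le[OF _ this _ denom] have "gf_exceed x l \<le> 2 * (x ^ l * (1 - x)\<^sup>2 * 2) / (1 / 2 * (1 / 2))"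
    unfolding gf_exceed_def using x by simp
  then show ?thesis by simp
qed

section \<open>From generating functions to a fixed number of edges\<close>

text \<open>Each of the \<open>n + 1\<close> terms is at least \<open>A\<close>, the Catalan lower
  bound evaluated at the worst index \<open>2 * n\<close>. The 6 comes from
  \<open>sqrt 2 \<le> 3 / 2\<close>.\<close>

lemma sum_num_trees_UNIV_ge:
  fixes z :: real
  assumes z: "0 < z" "12 * z \<le> 1" and n: "n \<ge> 1"
  shows "(12 * z) ^ (2 * n) / (6 * sqrt n) \<le> (\<Sum>m=n..2 * n. num_trees UNIV m 0 * z ^ m)"
proof -
  define A where "A = (12 * z) ^ (2 * n) / (2 * sqrt (2 * n) * (2 * real n + 1))"
  have A: "A \<le> num_trees UNIV m 0 * z ^ m" if m: "m \<in> {n..2 * n}" for m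
  proof -
    have pos: "2 * sqrt m * (real m + 1) > 0" using m n by simp
    have "A \<le> (12 * z) ^ m / (2 * sqrt m * (real m + 1))"
      unfolding A_def
    proof (rule frac_le)
      show "(12 * z) ^ (2 * n) \<le> (12 * z) ^ m" using z m by (intro power_decreasing) auto
      show "2 * sqrt m * (real m + 1) \<le> 2 * sqrt (2 * n) * (2 * real n + 1)"
        using m by (intro mult_mono) auto
    qed (use z pos in auto)
    also have "(12 * z) ^ m = (3 * z) ^ m * 4 ^ m"
      unfolding power_mult_distrib[symmetric] by (simp only: mult.commute mult.assoc) simp
    also have "(3 * z) ^ m * 4 ^ m / (2 * sqrt m * (real m + 1))
        \<le> (3 * z) ^ m * (2 * sqrt m * (real m + 1) * real (catalan m)) / (2 * sqrt m * (real m + 1))"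
      using m n z pos by (intro divide_right_mono mult_left_mono catalan_lower_bound) auto
    also have "\<dots> = num_trees UNIV m 0 * z ^ m"
      using pos m n unfolding num_trees_UNIV power_mult_distrib by simp
    finally show ?thesis .
  qed
  have "sqrt 2 \<le> 3 / 2" by (rule real_le_lsqrt) (auto simp: power2_eq_square)
  then have "sqrt 2 * sqrt n \<le> 3 / 2 * sqrt n" by (intro mult_right_mono) auto
  then have "2 * sqrt (2 * n) * (2 * real n + 1) \<le> 2 * (3 / 2 * sqrt n) * (2 * real (n + 1))"
    by (intro mult_mono) (simp_all add: real_sqrt_mult)
  then have "2 * sqrt (2 * n) * (2 * real n + 1) \<le> real (n + 1) * (6 * sqrt n)"
    by (simp add: mult_ac)
  moreover have "1 / b \<le> k / a" if "a \<le> k * b" "a > 0" "b > 0" for a b k :: real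
    using that by (simp add: field_simps)
  ultimately have "1 / (6 * sqrt n) \<le> real (n + 1) / (2 * sqrt (2 * n) * (2 * real n + 1))"
    using n by simp
  then have "(12 * z) ^ (2 * n) * (1 / (6 * sqrt n))
      \<le> (12 * z) ^ (2 * n) * (real (n + 1) / (2 * sqrt (2 * n) * (2 * real n + 1)))"
    using z by (intro mult_left_mono) auto
  then have "(12 * z) ^ (2 * n) / (6 * sqrt n) \<le> real (card {n..2 * n}) * A"
    by (simp add: A_def mult.commute)
  also have "\<dots> \<le> (\<Sum>m=n..2 * n. num_trees UNIV m 0 * z ^ m)"
    by (rule sum_bounded_below) (rule A)
  finally show ?thesis .
qed

text \<open>Since \<open>1 - q m\<close> increases with \<open>m\<close>, its value at
  \<open>n\<close> times the sum over \<open>{n..2 * n}\<close> is at most the full difference of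
  the generating functions, which \<open>gf_exceed\<close> bounds.\<close>

lemma one_minus_proportion_le:
  assumes x: "0 < x" "x < 1" and half: "x ^ l \<le> 1 / 2" and n: "n \<ge> 1"
  shows "1 - num_trees {..<int l} n 0 / num_trees UNIV n 0
    \<le> 6 * sqrt n * (1 + (1 - x) ^ 4 / (12 * x)) ^ (2 * n) * (16 * x ^ l * (1 - x)\<^sup>2)"
proof -
  define z where "z = x * (1 + x + x\<^sup>2) / (1 + 4 * x + x\<^sup>2)\<^sup>2"
  define R where "R = (1 + 4 * x + x\<^sup>2) / (1 + x + x\<^sup>2)"
  define S where "S = {..<int l}"
  define q where "q m = num_trees S m 0 / num_trees UNIV m 0" for m
  have pos: "1 + x + x\<^sup>2 > 0" "1 + 4 * x + x\<^sup>2 > 0" using x by (simp_all add: add_pos_nonneg)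
  have zpos: "z > 0" using x pos by (simp add: z_def)
  have zR: "z * R\<^sup>2 = x / (1 + x + x\<^sup>2)"
    using pos unfolding z_def R_def by (simp add: power2_eq_square)
  interpret subcritical z R
  proof
    show "z \<ge> 0" "R \<ge> 0" using x pos by (simp_all add: z_def R_def)
    show "R = 1 + 3 * z * R\<^sup>2"
      unfolding mult.assoc zR unfolding R_def using pos by (simp add: field_simps)
    have "0 < (1 - x)\<^sup>2" using x by simp
    then show "3 * z * R\<^sup>2 < 1"
      unfolding mult.assoc zR using pos by (simp add: field_simps power2_eq_square)
  qed
  have "gf z UNIV 0 - gf z S 0 \<le> gf_exceed x (nat (int l - 0))"
  proof (rule gf_diff_le)
    fix a :: int
    show "0 \<le> gf_exceed x (nat (int l - a))" using x by (rule gf_exceed_nonneg)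
    show "R \<le> gf_exceed x (nat (int l - a))" if "a \<notin> S"
      using that gf_exceed_0[OF x] by (simp add: S_def R_def)
    assume "a \<in> S"
    define k where "k = nat (int l - a) - 1"
    have k: "nat (int l - a) = k + 1" "nat (int l - (a - 1)) = k + 2" "nat (int l - (a + 1)) = k"
      using \<open>a \<in> S\<close> by (auto simp: S_def k_def)
    show "gf_exceed x (nat (int l - a)) * (1 + z * R * (gf_exceed x (nat (int l - (a - 1)))
          + gf_exceed x (nat (int l - a)) + gf_exceed x (nat (int l - (a + 1)))))
        = z * R\<^sup>2 * (gf_exceed x (nat (int l - (a - 1)))
          + gf_exceed x (nat (int l - a)) + gf_exceed x (nat (int l - (a + 1))))"
      unfolding k using gf_exceed_Suc[OF x, of k] unfolding z_def R_def by (simp only: add_ac)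
  qed
  then have gf: "gf z UNIV 0 - gf z S 0 \<le> 16 * x ^ l * (1 - x)\<^sup>2"
    using gf_exceed_le[OF x half] by simp
  have cpos: "num_trees UNIV m 0 > 0" for m using catalan_pos[of m] by (simp add: num_trees_UNIV)
  have q_le: "q m \<le> q n" if "n \<le> m" for m
    by (rule lift_Suc_antimono_le[OF _ that]) (simp only: q_def proportion_antimono)
  have "q n \<le> 1" using num_trees_mono[of S UNIV n 0] cpos[of n] by (simp add: q_def divide_le_eq)
  \<comment> \<open>Thus \<open>1 - 12 * z\<close> is a multiple of \<open>(1 - x) ^ 4\<close>, the
    source of the fourth-root scaling.\<close>
  have fourth: "(1 + 4 * x + x\<^sup>2)\<^sup>2 = 12 * (x * (1 + x + x\<^sup>2)) + (1 - x) ^ 4"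
    by (simp add: power2_eq_square power4_eq_xxxx algebra_simps)
  have z12: "12 * z \<le> 1"
  proof -
    have "0 \<le> (1 - x) ^ 4" using x by simp
    then show ?thesis unfolding z_def fourth using x pos by (simp add: divide_le_eq add_pos_nonneg)
  qed
  have inv: "1 / (12 * z) \<le> 1 + (1 - x) ^ 4 / (12 * x)"
  proof -
    have "1 / (12 * (p / (12 * p + d))) = 1 + d / (12 * p)" if "p > 0" for p d :: real
      using that by (simp add: field_simps)
    from this[of "x * (1 + x + x\<^sup>2)" "(1 - x) ^ 4"]
    have "1 / (12 * z) = 1 + (1 - x) ^ 4 / (12 * (x * (1 + x + x\<^sup>2)))"
      unfolding z_def fourth using x pos by simp
    also have "\<dots> \<le> 1 + (1 - x) ^ 4 / (12 * x)"
      using x pos by (intro add_left_mono divide_left_mono) auto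
    finally show ?thesis .
  qed
  have "(1 - q n) * ((12 * z) ^ (2 * n) / (6 * sqrt n))
      \<le> (1 - q n) * (\<Sum>m=n..2 * n. num_trees UNIV m 0 * z ^ m)"
    using sum_num_trees_UNIV_ge[OF zpos z12 n] \<open>q n \<le> 1\<close> by (intro mult_left_mono) auto
  also have "\<dots> \<le> (\<Sum>m=n..2 * n. num_trees UNIV m 0 * z ^ m - num_trees S m 0 * z ^ m)"
    unfolding sum_distrib_left
  proof (rule sum_mono)
    fix m assume "m \<in> {n..2 * n}"
    then have "(1 - q n) * (num_trees UNIV m 0 * z ^ m) \<le> (1 - q m) * (num_trees UNIV m 0 * z ^ m)"
      using q_le[of m] zpos by (intro mult_right_mono) auto
    also have "\<dots> = num_trees UNIV m 0 * z ^ m - num_trees S m 0 * z ^ m"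
      using cpos[of m] by (simp add: q_def left_diff_distrib)
    finally show "(1 - q n) * (num_trees UNIV m 0 * z ^ m)
        \<le> num_trees UNIV m 0 * z ^ m - num_trees S m 0 * z ^ m" .
  qed
  also have "\<dots> \<le> (\<Sum>m. num_trees UNIV m 0 * z ^ m - num_trees S m 0 * z ^ m)"
    using zpos by (intro sum_le_suminf summable_diff summable_num_trees)
      (auto intro!: mult_right_mono num_trees_mono)
  also have "\<dots> = gf z UNIV 0 - gf z S 0"
    unfolding gf_def by (intro suminf_diff[symmetric] summable_num_trees)
  also note gf
  finally have main: "(1 - q n) * ((12 * z) ^ (2 * n) / (6 * sqrt n)) \<le> 16 * x ^ l * (1 - x)\<^sup>2" .
  have "1 - q n = 6 * sqrt n * (1 / (12 * z)) ^ (2 * n)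
      * ((1 - q n) * ((12 * z) ^ (2 * n) / (6 * sqrt n)))"
    using zpos n by (simp add: power_divide)
  also have "\<dots> \<le> 6 * sqrt n * (1 + (1 - x) ^ 4 / (12 * x)) ^ (2 * n) * (16 * x ^ l * (1 - x)\<^sup>2)"
  proof (rule mult_mono)
    show "6 * sqrt n * (1 / (12 * z)) ^ (2 * n) \<le> 6 * sqrt n * (1 + (1 - x) ^ 4 / (12 * x)) ^ (2 * n)"
      using inv zpos by (intro mult_left_mono power_mono) auto
  qed (use main x zpos \<open>q n \<le> 1\<close> in auto)
  finally show ?thesis by (simp add: q_def S_def)
qed

section \<open>From label bounds to the supremum of the contour process\<close>

lemma label_contour: "u \<in> set (contour T) \<Longrightarrow> label u \<in> set_plane_tree T"
proof (induction T)
  case (Node a ts)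
  then have "u = Node a ts \<or> (\<exists>t\<in>set ts. u \<in> set (contour t))"
    by (auto split: if_splits)
  then show ?case using Node.IH by auto
qed

text \<open>Integer labels below \<open>l\<close> are at most \<open>l - 1\<close>, whence the
  \<open>+ 1\<close> in the condition on \<open>l\<close>.\<close>

lemma SUP_W_hat_le:
  assumes n: "n \<ge> 1" and T: "T \<in> trees {..<int l} n 0"
    and l: "real l \<le> c * (8 * real n / 9) powr (1 / 4) + 1"
  shows "(SUP s\<in>{0..1}. W_hat n T s) \<le> c"
proof (rule cSUP_least)
  fix s :: real assume s: "s \<in> {0..1}"
  define k where "k = nat \<lfloor>2 * real n * s\<rfloor>"
  have "T \<in> labelled_trees n" using T by (simp add: labelled_trees_def trees_def)
  then have "contour T ! k \<in> set (contour T)"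
    unfolding k_def using s by (intro nth_mem contour_index_less)
  then have "V T k < int l"
    unfolding V_def using label_contour[of "contour T ! k" T] T by (auto simp: trees_def)
  then have "real_of_int (V T k) \<le> c * (8 * real n / 9) powr (1 / 4)" using l by linarith
  then show "W_hat n T s \<le> c"
    unfolding W_hat_def k_def[symmetric] using n by (simp add: divide_le_eq)
qed simp

lemma prob_SUP_W_hat_le:
  assumes n: "n \<ge> 1" and l: "real l \<le> c * (8 * real n / 9) powr (1 / 4) + 1"
  shows "measure_pmf.prob (U n) {T. (SUP s\<in>{0..1}. W_hat n T s) > c}
    \<le> 1 - num_trees {..<int l} n 0 / num_trees UNIV n 0"
proof -
  let ?A = "{T. (SUP s\<in>{0..1}. W_hat n T s) > c}"
  have eq: "labelled_trees n = trees UNIV n 0"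
    by (simp add: labelled_trees_def trees_def)
  have sub: "trees {..<int l} n 0 \<subseteq> trees UNIV n 0" by (auto simp: trees_def)
  have pos: "card (trees UNIV n 0) > 0"
    using labelled_trees_nonempty[of n] by (simp add: eq card_gt_0_iff finite_trees)
  have "labelled_trees n \<inter> ?A \<subseteq> trees UNIV n 0 - trees {..<int l} n 0"
    using SUP_W_hat_le[OF n _ l] by (fastforce simp: eq)
  then have "card (labelled_trees n \<inter> ?A) \<le> card (trees UNIV n 0 - trees {..<int l} n 0)"
    by (intro card_mono) (simp_all add: finite_trees)
  also have "\<dots> = card (trees UNIV n 0) - card (trees {..<int l} n 0)"
    by (rule card_Diff_subset[OF finite_trees sub])
  finally have "real (card (labelled_trees n \<inter> ?A)) \<le> num_trees UNIV n 0 - num_trees {..<int l} n 0"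
    unfolding num_trees_def using card_mono[OF finite_trees sub] by linarith
  then have "measure_pmf.prob (U n) ?A \<le> (num_trees UNIV n 0 - num_trees {..<int l} n 0) / num_trees UNIV n 0"
    unfolding U_def measure_pmf_of_set[OF labelled_trees_nonempty finite_labelled_trees]
    by (simp add: eq num_trees_def divide_right_mono)
  then show ?thesis using pos by (simp add: num_trees_def diff_divide_distrib)
qed

section \<open>Choice of the parameters\<close>

theorem proposition4:
  "\<exists>y0::real. y0 > 0 \<and>
     (\<forall>y>y0. \<forall>n::nat. n \<ge> 1 \<longrightarrow>
        measure_pmf.prob (U n) {T. (SUP s\<in>{0..1}. W_hat n T s) > (8 / 9) powr (1 / 4) * y}
          \<le> exp (- y))"
\<comment> \<open>The final exponent \<open>42 - 16 / 9 * y\<close> is at most \<open>- y\<close>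
  exactly when \<open>y \<ge> 54\<close>.\<close>
proof (intro exI[of _ 54] conjI allI impI)
  fix y :: real and n :: nat assume y: "y > 54" and n: "n \<ge> 1"
  define r where "r = real n powr (1 / 4)"
  have r: "r \<ge> 1" "r\<^sup>2 = sqrt n" "r ^ 4 = n"
    using n by (simp_all add: r_def ge_one_powr_ge_zero powr_power powr_half_sqrt)
  define l where "l = nat \<lfloor>8 / 9 * y * r\<rfloor> + 1"
  \<comment> \<open>The 2 makes \<open>x ^ l\<close> decay at rate \<open>16 / 9\<close>, which
    exceeds 1 and so leaves room for the constant factors.\<close>
  define x where "x = exp (- (2 / r))"
  have x: "0 < x" "x < 1" using r by (simp_all add: x_def)
  have l_ge: "8 / 9 * y * r \<le> real l" and l_le: "real l \<le> 8 / 9 * y * r + 1"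
  proof -
    have "0 \<le> 8 / 9 * y * r" using y r by simp
    then show "8 / 9 * y * r \<le> real l" "real l \<le> 8 / 9 * y * r + 1"
      unfolding l_def by linarith+
  qed
  \<comment> \<open>The two fourth roots multiply to the square root of \<open>8 / 9\<close>, which
    is bounded below by the rational \<open>8 / 9\<close>.\<close>
  have scale: "8 / 9 * y * r \<le> (8 / 9) powr (1 / 4) * y * (8 * real n / 9) powr (1 / 4)"
  proof -
    have "(8 / 9 :: real) powr 1 \<le> (8 / 9) powr (1 / 4 + 1 / 4)" by (rule powr_mono') auto
    then have "8 / 9 \<le> (8 / 9 :: real) powr (1 / 4) * (8 / 9) powr (1 / 4)"
      unfolding powr_add by simp
    then have "8 / 9 * (y * r) \<le> (8 / 9) powr (1 / 4) * (8 / 9) powr (1 / 4) * (y * r)"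
      using y r by (intro mult_right_mono) auto
    moreover have "(8 * real n / 9) powr (1 / 4) = (8 / 9) powr (1 / 4) * r"
      unfolding r_def by (simp flip: powr_mult)
    ultimately show ?thesis by (simp add: mult_ac)
  qed
  have x_pow: "x ^ l \<le> exp (- (16 / 9 * y))"
  proof -
    have "16 / 9 * y = 2 / r * (8 / 9 * y * r)" using r by simp
    also have "\<dots> \<le> 2 / r * real l" using l_ge r by (intro mult_left_mono) auto
    finally show ?thesis unfolding x_def by (simp add: mult.commute flip: exp_of_nat_mult)
  qed
  have x_sub: "1 - x \<le> 2 / r" using exp_ge_add_one_self[of "- (2 / r)"] by (simp add: x_def)
  have half: "x ^ l \<le> 1 / 2"
  proof -
    have "2 \<le> exp (16 / 9 * y)" using exp_ge_add_one_self[of "16 / 9 * y"] y by linarith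
    then have "exp (- (16 / 9 * y)) \<le> 1 / 2" by (simp add: exp_minus field_simps)
    then show ?thesis using x_pow by linarith
  qed
  \<comment> \<open>\<open>r \<ge> 1\<close> gives \<open>12 * x \<ge> 1\<close>, which removes the
    denominator, and \<open>(1 - x) ^ 4 \<le> 16 / n\<close> cancels the exponent
    \<open>2 * n\<close>.\<close>
  have pow_n: "(1 + (1 - x) ^ 4 / (12 * x)) ^ (2 * n) \<le> exp 32"
  proof -
    have "exp 2 \<le> (12 :: real)"
      using power_mono[OF exp_le, of 2] by (simp flip: exp_of_nat_mult)
    moreover have "exp (2 / r) \<le> exp 2" using r by (simp add: divide_le_eq)
    ultimately have "exp (2 / r) \<le> 12" by (rule order_trans[rotated])
    then have "1 \<le> 12 * x" unfolding x_def by (simp add: exp_minus field_simps)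
    then have "(1 - x) ^ 4 / (12 * x) \<le> (1 - x) ^ 4 / 1"
      using x by (intro divide_left_mono) auto
    also have "\<dots> \<le> (2 / r) ^ 4" using x_sub x by (simp add: power_mono)
    also have "\<dots> = 16 / n" by (simp add: power_divide r)
    finally have "1 + (1 - x) ^ 4 / (12 * x) \<le> exp (16 / n)"
      using exp_ge_add_one_self[of "16 / n"] by linarith
    then have "(1 + (1 - x) ^ 4 / (12 * x)) ^ (2 * n) \<le> exp (16 / n) ^ (2 * n)"
      using x by (intro power_mono) (auto intro!: add_nonneg_nonneg)
    also have "\<dots> = exp 32" using n by (simp flip: exp_of_nat_mult)
    finally show ?thesis .
  qed
  have "measure_pmf.prob (U n) {T. (SUP s\<in>{0..1}. W_hat n T s) > (8 / 9) powr (1 / 4) * y}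
      \<le> 1 - num_trees {..<int l} n 0 / num_trees UNIV n 0"
    using scale l_le by (intro prob_SUP_W_hat_le n) simp
  also have "\<dots> \<le> 6 * sqrt n * (1 + (1 - x) ^ 4 / (12 * x)) ^ (2 * n) * (16 * x ^ l * (1 - x)\<^sup>2)"
    by (rule one_minus_proportion_le[OF x half n])
  also have "\<dots> \<le> 6 * sqrt n * exp 32 * (16 * exp (- (16 / 9 * y)) * (2 / r)\<^sup>2)"
    using pow_n x_pow x_sub x by (intro mult_mono power_mono) auto
  \<comment> \<open>Here \<open>sqrt n\<close> cancels against \<open>r\<^sup>2\<close>, leaving
    \<open>6 * 16 * 4\<close>.\<close>
  also have "\<dots> = 384 * (exp 32 * exp (- (16 / 9 * y)))"
    using n by (simp add: power_divide r)
  also have "\<dots> \<le> exp 10 * (exp 32 * exp (- (16 / 9 * y)))"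
  proof (rule mult_right_mono)
    have "(2 :: real) ^ 10 \<le> exp 1 ^ 10"
      using exp_ge_add_one_self[of 1] by (intro power_mono) auto
    then show "384 \<le> exp (10 :: real)" by (simp flip: exp_of_nat_mult)
  qed simp
  also have "\<dots> = exp (10 + (32 + - (16 / 9 * y)))" by (simp only: exp_add)
  also have "\<dots> \<le> exp (- y)" using y by simp
  finally show "measure_pmf.prob (U n) {T. (SUP s\<in>{0..1}. W_hat n T s) > (8 / 9) powr (1 / 4) * y}
      \<le> exp (- y)" .
qed simp

end
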